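(* Let $L>4$ and let $S\subseteq\mathbb{S}_L$ be a dense subset. Then any g.e.c. graph $G$ on vertex set $S$ defines, in the language of graphs and with parameters from $S$, the ternary relations $\{C_{z,t,k}: z,t,k\in\mathbb{Z}\}$ on $S$ and the partial functions $f_z: a\mapsto a+z$ on $S$ (defined at those $a\in S$ with $a+z\in S$), for all $z\in\mathbb{Z}$.
   Context: For real $L\ge2$, the circle of length $L$ is the quotient group $\mathbb{S}_L=(\mathbb{R}/L\mathbb{Z},+_L)$; for $x\in\mathbb{R}$ write $[x]=x+L\mathbb{Z}$, and for $a\in \mathbb{S}_L$, $z\in\mathbb{Z}$ write $a+z$ for $a+_L[z]$. It carries the metric $d_L(a,b)=\min\{|x-y|,L-|x-y|\}$, where $x,y\in[0,L)$ are the unique elements with $[x]=a,[y]=b$. The circular order $C(a,b,c)$ on $\mathbb{S}_L$ holds iff $x<y<z$ or $y<z<x$ or $z<x<y$, where $x,y,z\in[0,L)$ are such that $[x]=a,[y]=b,[z]=c$. For $z,t,k\in\mathbb{Z}$ and $a,b,c\in S$, $C_{z,t,k}(a,b,c)$ holds iff $C(a+z,b+t,c+k)$. Let $(X,d)$ be a separable metric space without isolated points and $S\subseteq X$ dense. A (simple, undirected) graph $G$ with vertex set $S$ is geometrically existentially closed (g.e.c.) if (i) any two adjacent $u,v\in S$ satisfy $d(u,v)<1$; and (ii) for any vertex $s\in S$, any disjoint finite sets $A,B\subseteq S$ contained in the open unit ball $B_1(s)$, and any $\epsilon>0$, there is a vertex $v\in S\setminus(A\cup B)$ with $d(s,v)<\epsilon$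 such that $v$ is adjacent to every vertex in $A$ and to no vertex in $B$. *)

theory Defs
  imports "HOL-Analysis.Analysis" "HOL-Algebra.Coset"
begin

section \<open>The circle of length L\<close>

definition real_add :: "real monoid" where
  "real_add = \<lparr>carrier = UNIV, monoid.mult = (+), one = 0\<rparr>"

definition lattice_of :: "real \<Rightarrow> real set" where
  "lattice_of L = range (\<lambda>k::int. L * of_int k)"

definition circle :: "real \<Rightarrow> real set monoid" where
  "circle L = real_add Mod lattice_of L"

definition circle_class :: "real \<Rightarrow> real \<Rightarrow> real set" where
  "circle_class L x = lattice_of L #>\<^bsub>real_add\<^esub> x"

text \<open>
  For points of the circle this is the unique representative in \<open>[0, L)\<close>
  (see \<open>circle_repr_unique\<close> below).  The value \<open>0\<close> elsewhere only makes the distance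
  below symmetric and nonnegative on the whole type, as \<^locale>\<open>Metric_space\<close> requires.
\<close>
definition circle_rep :: "real \<Rightarrow> real set \<Rightarrow> real" where
  "circle_rep L a =
     (if a \<in> carrier (circle L) then THE x. 0 \<le> x \<and> x < L \<and> circle_class L x = a else 0)"

definition circle_dist :: "real \<Rightarrow> real set \<Rightarrow> real set \<Rightarrow> real" where
  "circle_dist L a b =
     (let x = circle_rep L a; y = circle_rep L b in min \<bar>x - y\<bar> (L - \<bar>x - y\<bar>))"

definition circ_order :: "real \<Rightarrow> real set \<Rightarrow> real set \<Rightarrow> real set \<Rightarrow> bool" where
  "circ_order L a b c \<longleftrightarrow>
     (let x = circle_rep L a; y = circle_rep L b; z = circle_rep L c
      in (x < y \<and> y < z) \<or> (y < z \<and> z < x) \<or> (z < x \<and> x < y))"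

definition circle_shift :: "real \<Rightarrow> real set \<Rightarrow> int \<Rightarrow> real set" where
  "circle_shift L a z = a \<otimes>\<^bsub>circle L\<^esub> circle_class L (of_int z)"

definition circ_order_shift ::
    "real \<Rightarrow> int \<Rightarrow> int \<Rightarrow> int \<Rightarrow> real set \<Rightarrow> real set \<Rightarrow> real set \<Rightarrow> bool" where
  "circ_order_shift L z t k a b c \<longleftrightarrow>
     circ_order L (circle_shift L a z) (circle_shift L b t) (circle_shift L c k)"

definition shift_pfun :: "real \<Rightarrow> real set set \<Rightarrow> int \<Rightarrow> real set \<rightharpoonup> real set" where
  "shift_pfun L S z =
     (\<lambda>a. if a \<in> S \<and> circle_shift L a z \<in> S then Some (circle_shift L a z) else None)"

section \<open>Geometrically existentially closed graphs\<close>

definition simple_graph :: "'a set \<Rightarrow> 'a rel \<Rightarrow> bool" where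
  "simple_graph S E \<longleftrightarrow> E \<subseteq> S \<times> S \<and> sym E \<and> irrefl E"

definition dense_in :: "'a set \<Rightarrow> ('a \<Rightarrow> 'a \<Rightarrow> real) \<Rightarrow> 'a set \<Rightarrow> bool" where
  "dense_in X d S \<longleftrightarrow> S \<subseteq> X \<and> Metric_space.mtopology X d closure_of S = X"

text \<open>
  The space \<open>(X, d)\<close> is meant to be a separable metric space without isolated points, \<open>S\<close> dense
  in it, and \<open>E\<close> the adjacency relation of a simple graph on \<open>S\<close>; these conditions are not part
  of the predicate.
\<close>
definition gec :: "'a set \<Rightarrow> ('a \<Rightarrow> 'a \<Rightarrow> real) \<Rightarrow> 'a set \<Rightarrow> 'a rel \<Rightarrow> bool" where
  "gec X d S E \<longleftrightarrow>
     (\<forall>u\<in>S. \<forall>v\<in>S. (u, v) \<in> E \<longrightarrow> d u v < 1) \<and>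
     (\<forall>s\<in>S. \<forall>A B. \<forall>\<epsilon>>0.
        finite A \<and> finite B \<and> A \<subseteq> S \<and> B \<subseteq> S \<and> A \<inter> B = {} \<and>
        A \<subseteq> Metric_space.mball X d s 1 \<and> B \<subseteq> Metric_space.mball X d s 1 \<longrightarrow>
        (\<exists>v \<in> S - (A \<union> B). d s v < \<epsilon> \<and>
           (\<forall>a\<in>A. (v, a) \<in> E) \<and> (\<forall>b\<in>B. (v, b) \<notin> E)))"

section \<open>First-order definability with parameters in a graph\<close>

datatype 'a trm = Var nat | Param 'a

datatype 'a fml =
    Eq "'a trm" "'a trm"
  | Adj "'a trm" "'a trm"
  | Neg "'a fml"
  | Conj "'a fml" "'a fml"
  | Exi nat "'a fml"

fun fv_trm :: "'a trm \<Rightarrow> nat set" where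
  "fv_trm (Var i) = {i}"
| "fv_trm (Param p) = {}"

fun fv :: "'a fml \<Rightarrow> nat set" where
  "fv (Eq t u) = fv_trm t \<union> fv_trm u"
| "fv (Adj t u) = fv_trm t \<union> fv_trm u"
| "fv (Neg \<phi>) = fv \<phi>"
| "fv (Conj \<phi> \<psi>) = fv \<phi> \<union> fv \<psi>"
| "fv (Exi i \<phi>) = fv \<phi> - {i}"

abbreviation params :: "'a fml \<Rightarrow> 'a set" where
  "params \<equiv> set_fml"

fun val :: "(nat \<Rightarrow> 'a) \<Rightarrow> 'a trm \<Rightarrow> 'a" where
  "val e (Var i) = e i"
| "val e (Param p) = p"

fun sat :: "'a set \<Rightarrow> 'a rel \<Rightarrow> (nat \<Rightarrow> 'a) \<Rightarrow> 'a fml \<Rightarrow> bool" where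
  "sat S E e (Eq t u) \<longleftrightarrow> val e t = val e u"
| "sat S E e (Adj t u) \<longleftrightarrow> (val e t, val e u) \<in> E"
| "sat S E e (Neg \<phi>) \<longleftrightarrow> \<not> sat S E e \<phi>"
| "sat S E e (Conj \<phi> \<psi>) \<longleftrightarrow> sat S E e \<phi> \<and> sat S E e \<psi>"
| "sat S E e (Exi i \<phi>) \<longleftrightarrow> (\<exists>a\<in>S. sat S E (e(i := a)) \<phi>)"

text \<open>
  An \<open>n\<close>-ary relation on \<open>S\<close> is a set of lists of length \<open>n\<close> over \<open>S\<close>; entry number \<open>i\<close> is
  assigned to variable \<open>i\<close>.  The values of \<open>xs ! i\<close> for \<open>i \<ge> n\<close> are irrelevant because of the
  restriction on free variables.
\<close>
definition definable_rel :: "'a set \<Rightarrow> 'a rel \<Rightarrow> nat \<Rightarrow> 'a list set \<Rightarrow> bool" where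
  "definable_rel S E n R \<longleftrightarrow>
     (\<exists>\<phi>. params \<phi> \<subseteq> S \<and> fv \<phi> \<subseteq> {..<n} \<and>
        R = {xs. length xs = n \<and> set xs \<subseteq> S \<and> sat S E (\<lambda>i. xs ! i) \<phi>})"

definition definable_pfun :: "'a set \<Rightarrow> 'a rel \<Rightarrow> ('a \<rightharpoonup> 'a) \<Rightarrow> bool" where
  "definable_pfun S E f \<longleftrightarrow> definable_rel S E 2 {[a, b] | a b. f a = Some b}"

section \<open>Basic facts about the circle\<close>

lemma circle_class_eq: "circle_class L x = {x + L * of_int k | k::int. True}"
  by (auto simp: circle_class_def lattice_of_def r_coset_def real_add_def add.commute)

lemma carrier_circle: "carrier (circle L) = range (circle_class L)"
  by (auto simp: circle_def carrier_FactGroup circle_class_def real_add_def)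

lemma normal_lattice_of: "lattice_of L \<lhd> real_add"
proof -
  interpret comm_group real_add
    by (rule comm_groupI) (auto simp: real_add_def intro: exI[of _ "- x" for x])
  have inv: "inv\<^bsub>real_add\<^esub> x = - x" for x
    by (rule inv_equality) (auto simp: real_add_def)
  have "subgroup (lattice_of L) real_add"
  proof
    fix x y assume "x \<in> lattice_of L" "y \<in> lattice_of L"
    then obtain j k :: int where "x = L * of_int j" "y = L * of_int k"
      by (auto simp: lattice_of_def)
    then have "x + y = L * of_int (j + k)" by (simp add: algebra_simps)
    then have "x + y \<in> lattice_of L" unfolding lattice_of_def by blast
    then show "x \<otimes>\<^bsub>real_add\<^esub> y \<in> lattice_of L" by (simp add: real_add_def)
  next
    show "\<one>\<^bsub>real_add\<^esub> \<in> lattice_of L"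
      by (auto simp: lattice_of_def real_add_def image_iff intro: exI[of _ 0])
  next
    fix x assume "x \<in> lattice_of L"
    then obtain j :: int where "x = L * of_int j" by (auto simp: lattice_of_def)
    then have "- x = L * of_int (- j)" by simp
    then show "inv\<^bsub>real_add\<^esub> x \<in> lattice_of L"
      unfolding inv lattice_of_def by blast
  qed (auto simp: real_add_def)
  then show ?thesis by (rule subgroup_imp_normal)
qed

lemma group_circle: "group (circle L)"
  unfolding circle_def by (rule normal.factorgroup_is_group[OF normal_lattice_of])

lemma circle_mult_class:
  "circle_class L x \<otimes>\<^bsub>circle L\<^esub> circle_class L y = circle_class L (x + y)"
  using normal.rcos_sum[OF normal_lattice_of, of x y L]
  by (simp add: circle_def circle_class_def real_add_def)

lemma circle_shift_class: "circle_shift L (circle_class L x) z = circle_class L (x + of_int z)"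
  by (simp add: circle_shift_def circle_mult_class)

lemma circle_class_eq_iff:
  "circle_class L x = circle_class L y \<longleftrightarrow> (\<exists>k::int. x = y + L * of_int k)"
proof
  assume eq: "circle_class L x = circle_class L y"
  have "x \<in> circle_class L x"
    unfolding circle_class_eq by (auto intro: exI[of _ 0])
  then show "\<exists>k::int. x = y + L * of_int k"
    unfolding eq by (auto simp: circle_class_eq)
next
  assume "\<exists>k::int. x = y + L * of_int k"
  then obtain k :: int where k: "x = y + L * of_int k" by blast
  have "y + L * of_int k + L * of_int j = y + L * of_int (k + j)"
    and "y + L * of_int j = y + L * of_int k + L * of_int (j - k)" for j
    by (simp_all add: algebra_simps)
  then show "circle_class L x = circle_class L y"
    unfolding circle_class_eq k by blast
qed

lemma circle_repr_unique:
  assumes L: "0 < L" and a: "a \<in> carrier (circle L)"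
  shows "\<exists>!x. 0 \<le> x \<and> x < L \<and> circle_class L x = a"
proof -
  obtain y where y: "a = circle_class L y" using a by (auto simp: carrier_circle)
  define x where "x = L * frac (y / L)"
  have "x = y + L * of_int (- \<lfloor>y / L\<rfloor>)"
    using L by (simp add: x_def frac_def algebra_simps)
  then have "circle_class L x = a" unfolding y circle_class_eq_iff by blast
  moreover have "0 \<le> x" "x < L"
    using L frac_lt_1[of "y / L"] by (simp_all add: x_def)
  moreover have "u = v"
    if "0 \<le> u" "u < L" "0 \<le> v" "v < L" and eq: "circle_class L u = circle_class L v" for u v
  proof -
    obtain k :: int where k: "u = v + L * of_int k"
      using eq circle_class_eq_iff by blast
    then have "L * of_int k < L * 1" "L * (- 1) < L * of_int k" using that(1-4) by linarith+
    then have "of_int k < (1::real)" "- 1 < (of_int k::real)"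
      using L mult_less_cancel_left_pos by blast+
    then have "k = 0" by linarith
    then show ?thesis using k by simp
  qed
  ultimately show ?thesis by metis
qed

lemma circle_rep:
  assumes "0 < L" "a \<in> carrier (circle L)"
  shows "0 \<le> circle_rep L a" "circle_rep L a < L" "circle_class L (circle_rep L a) = a"
  using theI'[OF circle_repr_unique[OF assms]] assms(2) by (simp_all add: circle_rep_def)

lemma Metric_space_circle:
  assumes L: "0 < L"
  shows "Metric_space (carrier (circle L)) (circle_dist L)"
proof
  have rep: "0 \<le> circle_rep L a \<and> circle_rep L a < L" for a
    using circle_rep[OF L] L by (cases "a \<in> carrier (circle L)") (auto simp: circle_rep_def)
  show "0 \<le> circle_dist L a b" for a b
    using rep[of a] rep[of b] by (auto simp: circle_dist_def Let_def)
  show "circle_dist L a b = circle_dist L b a" for a b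
    by (simp add: circle_dist_def Let_def abs_minus_commute)
  show "circle_dist L a b = 0 \<longleftrightarrow> a = b"
    if "a \<in> carrier (circle L)" "b \<in> carrier (circle L)" for a b
  proof
    assume "circle_dist L a b = 0"
    then have "circle_rep L a = circle_rep L b"
      using rep[of a] rep[of b] by (auto simp: circle_dist_def Let_def min_def split: if_splits)
    then show "a = b" using circle_rep(3)[OF L] that by metis
  qed (use L in \<open>simp add: circle_dist_def\<close>)
  show "circle_dist L a c \<le> circle_dist L a b + circle_dist L b c" for a b c
    using rep[of a] rep[of b] rep[of c]
    unfolding circle_dist_def Let_def min_def by (smt (verit))
qed

end

theory Submission
  imports Defs
begin

text \<open>
  Two vertices have a common neighbour iff their distance is less than 2.  Since \<open>L > 4\<close>, for
  close \<open>p < q\<close> the difference of the balls of radius 2 around \<open>p\<close> and \<open>q\<close> is the short arc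
  \<open>(p - 2, q - 2]\<close>, so a basis of short arcs is definable.  For \<open>x\<close>, \<open>y\<close> on a short arc the same
  difference lies near \<open>x - 2\<close> or near \<open>x + 2\<close> according to the order of \<open>x\<close> and \<open>y\<close>; this orders
  short arcs, and finitely many of them are concatenated to the whole circle.

  A point \<open>p\<close> outside \<open>S\<close> is handled through the arcs with endpoints in \<open>S\<close> that contain it.
  A vertex \<open>x\<close> with \<open>d(p, x) < 1\<close> has neighbours in every such arc, one with \<open>d(p, x) > 1\<close> does
  not.  Hence the arcs around \<open>p\<close> determine the vertices on either side of \<open>p + 1\<close> and \<open>p - 1\<close>,
  and so, by induction, the arcs around \<open>a + z\<close> are definable from \<open>a\<close>.
\<close>

section \<open>Definable predicates on assignments\<close>

text \<open>Working with predicates keeps the formulas implicit. Agreement is required only for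
  assignments into \<open>S\<close>, so facts about vertices may be used when one predicate is
  replaced by another.\<close>

definition definable_pred :: "'a set \<Rightarrow> 'a rel \<Rightarrow> nat set \<Rightarrow> ((nat \<Rightarrow> 'a) \<Rightarrow> bool) \<Rightarrow> bool" where
  "definable_pred S E V P \<longleftrightarrow>
     (\<exists>\<phi>. params \<phi> \<subseteq> S \<and> fv \<phi> \<subseteq> V \<and> (\<forall>e. (\<forall>i\<in>V. e i \<in> S) \<longrightarrow> (sat S E e \<phi> \<longleftrightarrow> P e)))"

lemma definable_pred_cong:
  assumes "definable_pred S E V P"
    and "\<And>e. (\<And>i. i \<in> V \<Longrightarrow> e i \<in> S) \<Longrightarrow> P e \<longleftrightarrow> Q e"
  shows "definable_pred S E V Q"
  using assms unfolding definable_pred_def by metis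

lemma definable_pred_adj:
  "i \<in> V \<Longrightarrow> j \<in> V \<Longrightarrow> definable_pred S E V (\<lambda>e. (e i, e j) \<in> E)"
  unfolding definable_pred_def by (rule exI[of _ "Adj (Var i) (Var j)"]) auto

lemma definable_pred_eq:
  "i \<in> V \<Longrightarrow> j \<in> V \<Longrightarrow> definable_pred S E V (\<lambda>e. e i = e j)"
  unfolding definable_pred_def by (rule exI[of _ "Eq (Var i) (Var j)"]) auto

lemma definable_pred_eq_param:
  "i \<in> V \<Longrightarrow> p \<in> S \<Longrightarrow> definable_pred S E V (\<lambda>e. e i = p)"
  unfolding definable_pred_def by (rule exI[of _ "Eq (Var i) (Param p)"]) auto

lemma definable_pred_not:
  assumes "definable_pred S E V P" shows "definable_pred S E V (\<lambda>e. \<not> P e)"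
proof -
  obtain \<phi> where "params \<phi> \<subseteq> S" "fv \<phi> \<subseteq> V" "\<forall>e. (\<forall>i\<in>V. e i \<in> S) \<longrightarrow> (sat S E e \<phi> \<longleftrightarrow> P e)"
    using assms unfolding definable_pred_def by blast
  then show ?thesis unfolding definable_pred_def by (intro exI[of _ "Neg \<phi>"]) auto
qed

lemma definable_pred_conj:
  assumes "definable_pred S E V P" "definable_pred S E V Q"
  shows "definable_pred S E V (\<lambda>e. P e \<and> Q e)"
proof -
  obtain \<phi> \<psi> where "params \<phi> \<subseteq> S" "fv \<phi> \<subseteq> V" "\<forall>e. (\<forall>i\<in>V. e i \<in> S) \<longrightarrow> (sat S E e \<phi> \<longleftrightarrow> P e)"
    "params \<psi> \<subseteq> S" "fv \<psi> \<subseteq> V" "\<forall>e. (\<forall>i\<in>V. e i \<in> S) \<longrightarrow> (sat S E e \<psi> \<longleftrightarrow> Q e)"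
    using assms unfolding definable_pred_def by blast
  then show ?thesis unfolding definable_pred_def by (intro exI[of _ "Conj \<phi> \<psi>"]) auto
qed

lemma definable_pred_disj:
  assumes "definable_pred S E V P" "definable_pred S E V Q"
  shows "definable_pred S E V (\<lambda>e. P e \<or> Q e)"
  using definable_pred_not[OF definable_pred_conj[OF assms[THEN definable_pred_not]]] by simp

lemma definable_pred_imp:
  assumes "definable_pred S E V P" "definable_pred S E V Q"
  shows "definable_pred S E V (\<lambda>e. P e \<longrightarrow> Q e)"
  unfolding imp_conv_disj by (intro definable_pred_disj definable_pred_not assms)

text \<open>Since \<open>V\<close> is finite, some index \<open>m\<close> outside it can carry the
  quantified vertex; by the third premise, overwriting that entry with the witness does not affect
  \<open>P\<close>.\<close>

lemma definable_pred_ex: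
  assumes "finite V"
    and "\<And>m. m \<notin> V \<Longrightarrow> definable_pred S E (insert m V) (\<lambda>e. P (e m) e)"
    and "\<And>m a e. m \<notin> V \<Longrightarrow> P a (e(m := a)) \<longleftrightarrow> P a e"
  shows "definable_pred S E V (\<lambda>e. \<exists>a\<in>S. P a e)"
proof -
  obtain m where m: "m \<notin> V" using assms(1) ex_new_if_finite infinite_UNIV_nat by blast
  obtain \<phi> where \<phi>: "params \<phi> \<subseteq> S" "fv \<phi> \<subseteq> insert m V"
      "\<And>e. (\<forall>i\<in>insert m V. e i \<in> S) \<Longrightarrow> (sat S E e \<phi> \<longleftrightarrow> P (e m) e)"
    using assms(2)[OF m] unfolding definable_pred_def by blast
  have "sat S E (e(m := a)) \<phi> \<longleftrightarrow> P a e" if "\<forall>i\<in>V. e i \<in> S" "a \<in> S" for e a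
    using \<phi>(3)[of "e(m := a)"] that assms(3)[OF m] by simp
  then show ?thesis
    unfolding definable_pred_def using \<phi>(1,2) by (intro exI[of _ "Exi m \<phi>"]) auto
qed

lemma definable_pred_all:
  assumes "finite V"
    and "\<And>m. m \<notin> V \<Longrightarrow> definable_pred S E (insert m V) (\<lambda>e. P (e m) e)"
    and "\<And>m a e. m \<notin> V \<Longrightarrow> P a (e(m := a)) \<longleftrightarrow> P a e"
  shows "definable_pred S E V (\<lambda>e. \<forall>a\<in>S. P a e)"
proof -
  have "definable_pred S E V (\<lambda>e. \<not> (\<exists>a\<in>S. \<not> P a e))"
    using assms(3) by (intro definable_pred_not definable_pred_ex assms(1,2)) blast+
  then show ?thesis by simp
qed

lemma definable_pred_param:
  assumes "finite V" "p \<in> S"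
    and "\<And>m. m \<notin> V \<Longrightarrow> definable_pred S E (insert m V) (\<lambda>e. P (e m) e)"
    and "\<And>m a e. m \<notin> V \<Longrightarrow> P a (e(m := a)) \<longleftrightarrow> P a e"
  shows "definable_pred S E V (P p)"
proof -
  have "definable_pred S E V (\<lambda>e. \<exists>a\<in>S. a = p \<and> P a e)"
    by (intro definable_pred_ex definable_pred_conj definable_pred_eq_param assms)
      (simp_all add: assms(4))
  then show ?thesis by (rule definable_pred_cong) (use assms(2) in auto)
qed

lemmas definable_pred_intros =
  definable_pred_adj definable_pred_eq definable_pred_not definable_pred_conj definable_pred_disj
  definable_pred_imp definable_pred_ex definable_pred_all

lemma definable_relI:
  assumes "definable_pred S E {..<n} P"
    and "\<And>xs. xs \<in> R \<longleftrightarrow> length xs = n \<and> set xs \<subseteq> S \<and> P (\<lambda>i. xs ! i)"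
  shows "definable_rel S E n R"
proof -
  obtain \<phi> where \<phi>: "params \<phi> \<subseteq> S" "fv \<phi> \<subseteq> {..<n}"
      "\<And>e. (\<forall>i\<in>{..<n}. e i \<in> S) \<Longrightarrow> (sat S E e \<phi> \<longleftrightarrow> P e)"
    using assms(1) unfolding definable_pred_def by blast
  have "R = {xs. length xs = n \<and> set xs \<subseteq> S \<and> sat S E (\<lambda>i. xs ! i) \<phi>}"
  proof (rule Set.set_eqI)
    fix xs
    have "sat S E (\<lambda>i. xs ! i) \<phi> \<longleftrightarrow> P (\<lambda>i. xs ! i)" if "length xs = n" "set xs \<subseteq> S"
      using that by (intro \<phi>(3)) (auto simp: subset_iff)
    then show "xs \<in> R \<longleftrightarrow> xs \<in> {xs. length xs = n \<and> set xs \<subseteq> S \<and> sat S E (\<lambda>i. xs ! i) \<phi>}"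
      unfolding assms(2) by blast
  qed
  then show ?thesis unfolding definable_rel_def using \<phi>(1,2) by blast
qed

section \<open>The circle in terms of real lifts\<close>

text \<open>Bounds by \<open>- L\<close>, \<open>0\<close> or \<open>L\<close> replace the nonlinear
  term, so that an estimate within less than one period forces \<open>k = 0\<close>.\<close>

lemma int_multiple_cases:
  fixes L :: real and k :: int
  assumes "0 < L"
  obtains "k = 0" "L * of_int k = 0" | "L \<le> L * of_int k" "1 \<le> k" | "L * of_int k \<le> - L" "k \<le> -1"
proof -
  consider "k = 0" | "1 \<le> k" | "k \<le> -1" by linarith
  then show thesis
  proof cases
    case 2
    then have "L * 1 \<le> L * of_int k" using assms by (intro mult_left_mono) auto
    then show ?thesis using that 2 by simp
  next
    case 3
    then have "of_int k \<le> (- 1 :: real)" by linarith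
    then have "L * of_int k \<le> L * (- 1)" using assms by (intro mult_left_mono) auto
    then show ?thesis using that 3 by simp
  qed (use that in simp)
qed

lemma int_multiple_0_1:
  fixes L :: real and k :: int
  assumes "0 < L" "- L < L * of_int k" "L * of_int k < 2 * L"
  shows "k = 0 \<or> k = 1"
proof -
  have "L * (- 1) < L * of_int k" "L * of_int k < L * 2"
    using assms(2,3) by linarith+
  then have "- 1 < (of_int k :: real)" "of_int k < (2 :: real)"
    using assms(1) mult_less_cancel_left_pos by blast+
  then show ?thesis by linarith
qed

lemma circle_class_add_period: "circle_class L (x + L * of_int k) = circle_class L x"
  unfolding circle_class_eq_iff by blast

lemma circle_rep_class:
  assumes "0 < L"
  obtains k :: int where "circle_rep L (circle_class L x) = x + L * of_int k"
    "0 \<le> x + L * of_int k" "x + L * of_int k < L"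
proof -
  have "circle_class L x \<in> carrier (circle L)" by (simp add: carrier_circle)
  from circle_rep[OF assms this] show thesis
    using that unfolding circle_class_eq_iff by metis
qed

lemma circle_dist_less_iff:
  assumes L: "0 < L"
  shows "circle_dist L (circle_class L x) (circle_class L y) < r
    \<longleftrightarrow> (\<exists>k::int. \<bar>x - y - L * of_int k\<bar> < r)"
proof -
  obtain i where i: "circle_rep L (circle_class L x) = x + L * of_int i"
    "0 \<le> x + L * of_int i" "x + L * of_int i < L" using circle_rep_class[OF L] by metis
  obtain j where j: "circle_rep L (circle_class L y) = y + L * of_int j"
    "0 \<le> y + L * of_int j" "y + L * of_int j < L" using circle_rep_class[OF L] by metis
  define u where "u = x + L * of_int i - (y + L * of_int j)"
  have u: "\<bar>u\<bar> < L" using i j by (simp add: u_def)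
  have d: "circle_dist L (circle_class L x) (circle_class L y) = min \<bar>u\<bar> (L - \<bar>u\<bar>)"
    by (simp add: circle_dist_def Let_def i(1) j(1) u_def)
  have xy: "x - y - L * of_int k = u - L * of_int (k + i - j)" for k
    by (simp add: u_def algebra_simps)
  show ?thesis
  proof
    assume "circle_dist L (circle_class L x) (circle_class L y) < r"
    then have "\<bar>u\<bar> < r \<or> \<bar>u - L\<bar> < r \<or> \<bar>u + L\<bar> < r" unfolding d using u by linarith
    then have "\<bar>u - L * of_int 0\<bar> < r \<or> \<bar>u - L * of_int 1\<bar> < r \<or> \<bar>u - L * of_int (- 1)\<bar> < r"
      by simp
    then obtain m :: int where "\<bar>u - L * of_int m\<bar> < r" by blast
    then have "\<bar>x - y - L * of_int (m - i + j)\<bar> < r" unfolding xy by simp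
    then show "\<exists>k::int. \<bar>x - y - L * of_int k\<bar> < r" ..
  next
    assume "\<exists>k::int. \<bar>x - y - L * of_int k\<bar> < r"
    then obtain m :: int where m: "\<bar>u - L * of_int m\<bar> < r" unfolding xy by blast
    show "circle_dist L (circle_class L x) (circle_class L y) < r"
      unfolding d using int_multiple_cases[OF L, of m] by cases (use m u in linarith)+
  qed
qed

text \<open>Moving the second and third points into the period that starts at \<open>x\<close> turns
  the three cyclic cases into one chain of inequalities.\<close>

lemma circ_order_iff:
  assumes L: "0 < L"
  shows "circ_order L (circle_class L x) (circle_class L y) (circle_class L z) \<longleftrightarrow>
    (\<exists>j k::int. x < y + L * of_int j \<and> y + L * of_int j < z + L * of_int k
       \<and> z + L * of_int k < x + L)" (is "?C x y z \<longleftrightarrow> ?R x y z")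
proof -
  obtain i where i: "circle_rep L (circle_class L x) = x + L * of_int i"
    "0 \<le> x + L * of_int i" "x + L * of_int i < L" using circle_rep_class[OF L] by metis
  obtain j where j: "circle_rep L (circle_class L y) = y + L * of_int j"
    "0 \<le> y + L * of_int j" "y + L * of_int j < L" using circle_rep_class[OF L] by metis
  obtain k where k: "circle_rep L (circle_class L z) = z + L * of_int k"
    "0 \<le> z + L * of_int k" "z + L * of_int k < L" using circle_rep_class[OF L] by metis
  define u v w where "u = x + L * of_int i" "v = y + L * of_int j" "w = z + L * of_int k"
  have bnd: "0 \<le> u" "u < L" "0 \<le> v" "v < L" "0 \<le> w" "w < L" using i j k u_v_w_def by auto
  have shift: "?R x y z" if "u < v + L * of_int m" "v + L * of_int m < w + L * of_int n"
      "w + L * of_int n < u + L" for m n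
    using that by (intro exI[of _ "m + j - i"] exI[of _ "n + k - i"])
      (simp add: u_v_w_def algebra_simps)
  show ?thesis
  proof
    assume "?C x y z"
    then consider "u < v" "v < w" | "v < w" "w < u" | "w < u" "u < v"
      by (auto simp: circ_order_def Let_def i(1) j(1) k(1) u_v_w_def)
    then show "?R x y z"
    proof cases
      \<comment> \<open>A representative smaller than \<open>u\<close> is raised by one period; this
        fixes the choices of \<open>0\<close> and \<open>1\<close>.\<close>
      case 1 then show ?thesis using shift[of 0 0] bnd by simp
    next
      case 2 then show ?thesis using shift[of 1 1] bnd by simp
    next
      case 3 then show ?thesis using shift[of 0 1] bnd by simp
    qed
  next
    assume "?R x y z"
    then obtain m n :: int where "x < y + L * of_int m" "y + L * of_int m < z + L * of_int n"
      "z + L * of_int n < x + L" by blast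
    then have *: "u < v + L * of_int (m - j + i)" "w + L * of_int (n - k + i) < u + L"
      "v + L * of_int (m - j + i) < w + L * of_int (n - k + i)"
      by (simp_all add: u_v_w_def algebra_simps)
    define q q' where "q = m - j + i" "q' = n - k + i"
    have "q = 0 \<or> q = 1" "q' = 0 \<or> q' = 1"
      using * bnd unfolding q_q'_def[symmetric] by (intro int_multiple_0_1[OF L]; linarith)+
    then have "(u < v \<and> v < w) \<or> (v < w \<and> w < u) \<or> (w < u \<and> u < v)"
      using * bnd unfolding q_q'_def[symmetric] by auto
    then show "?C x y z" by (simp add: circ_order_def Let_def i(1) j(1) k(1) u_v_w_def)
  qed
qed

lemma circ_orderE:
  assumes "0 < L" "circ_order L (circle_class L x) b c"
    and "b \<in> carrier (circle L)" "c \<in> carrier (circle L)"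
  obtains y z where "b = circle_class L y" "c = circle_class L z" "x < y" "y < z" "z < x + L"
proof -
  obtain y z where yz: "b = circle_class L y" "c = circle_class L z"
    using assms(3,4) by (auto simp: carrier_circle)
  then obtain j k :: int where "x < y + L * of_int j" "y + L * of_int j < z + L * of_int k"
    "z + L * of_int k < x + L" using assms(1,2) by (auto simp: circ_order_iff)
  then show thesis using that[of "y + L * of_int j" "z + L * of_int k"]
    by (simp add: yz circle_class_add_period)
qed

lemma circ_order_rotate: "circ_order L a b c \<longleftrightarrow> circ_order L b c a"
  by (auto simp: circ_order_def Let_def)

lemma circ_orderI:
  assumes "0 < L" "x < y" "y < z" "z < x + L"
  shows "circ_order L (circle_class L x) (circle_class L y) (circle_class L z)"
    and "circ_order L (circle_class L y) (circle_class L z) (circle_class L x)"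
    and "circ_order L (circle_class L z) (circle_class L x) (circle_class L y)"
proof -
  show "circ_order L (circle_class L x) (circle_class L y) (circle_class L z)"
    unfolding circ_order_iff[OF assms(1)] using assms by (intro exI[of _ 0]) simp
  then show "circ_order L (circle_class L y) (circle_class L z) (circle_class L x)"
    and "circ_order L (circle_class L z) (circle_class L x) (circle_class L y)"
    using circ_order_rotate by blast+
qed

text \<open>The two hypotheses lift \<open>c\<close> separately; both lifts lie strictly between
  \<open>x\<close> and \<open>x + L\<close>, hence they coincide.\<close>

lemma circ_order_chainE:
  assumes L: "0 < L" and "circ_order L (circle_class L x) b c" "circ_order L (circle_class L x) c d"
    "b \<in> carrier (circle L)" "c \<in> carrier (circle L)" "d \<in> carrier (circle L)"
  obtains y z w where "b = circle_class L y" "c = circle_class L z" "d = circle_class L w"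
    "x < y" "y < z" "z < w" "w < x + L"
proof -
  obtain y z where y: "b = circle_class L y" "c = circle_class L z" "x < y" "y < z" "z < x + L"
    using circ_orderE assms by metis
  obtain z' w where z: "c = circle_class L z'" "d = circle_class L w" "x < z'" "z' < w" "w < x + L"
    using circ_orderE assms by metis
  obtain k :: int where k: "z' = z + L * of_int k" using z y by (metis circle_class_eq_iff)
  have "k = 0" using int_multiple_cases[OF L, of k] by cases (use k y z in linarith)+
  then show thesis using that y z k by simp
qed

section \<open>Existentially closed graphs on the circle\<close>

locale gec_circle =
  fixes L :: real and S :: "real set set" and E :: "real set rel"
  assumes L: "L > 4"
    and dense: "dense_in (carrier (circle L)) (circle_dist L) S"
    and graph: "simple_graph S E"
    and gec: "gec (carrier (circle L)) (circle_dist L) S E"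
begin

abbreviation cls :: "real \<Rightarrow> real set" where "cls \<equiv> circle_class L"
abbreviation cyc :: "real set \<Rightarrow> real set \<Rightarrow> real set \<Rightarrow> bool" where "cyc \<equiv> circ_order L"
abbreviation dfn :: "nat set \<Rightarrow> ((nat \<Rightarrow> real set) \<Rightarrow> bool) \<Rightarrow> bool" where "dfn \<equiv> definable_pred S E"

lemma L0: "0 < L" using L by simp

lemma carrier_cls: "cls x \<in> carrier (circle L)" by (simp add: carrier_circle)

lemma S_carrier: "a \<in> S \<Longrightarrow> a \<in> carrier (circle L)"
  using dense by (auto simp: dense_in_def)

lemma S_cases: assumes "a \<in> S" obtains x where "a = cls x"
  using S_carrier[OF assms] by (auto simp: carrier_circle)

lemma dense_lift:
  assumes "u < v" obtains x where "u < x" "x < v" "cls x \<in> S"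
proof -
  interpret Metric_space "carrier (circle L)" "circle_dist L" by (rule Metric_space_circle[OF L0])
  have "cls ((u + v) / 2) \<in> mtopology closure_of S"
    using dense by (auto simp: dense_in_def carrier_circle)
  moreover have "0 < (v - u) / 2" using assms by simp
  ultimately have "\<exists>s\<in>S. s \<in> mball (cls ((u + v) / 2)) ((v - u) / 2)"
    unfolding metric_closure_of by blast
  then obtain s where s: "s \<in> S" "circle_dist L (cls ((u + v) / 2)) s < (v - u) / 2" by auto
  obtain y where y: "s = cls y" using s S_cases by blast
  obtain k :: int where k: "\<bar>(u + v) / 2 - y - L * of_int k\<bar> < (v - u) / 2"
    using s unfolding y circle_dist_less_iff[OF L0] by blast
  have "u < y + L * of_int k" "y + L * of_int k < v"
    using k unfolding abs_less_iff by (simp_all add: field_simps)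
  moreover have "cls (y + L * of_int k) \<in> S" using s by (simp add: y circle_class_add_period)
  ultimately show thesis using that by blast
qed

lemma adj_lift:
  assumes "(cls x, cls y) \<in> E" obtains k :: int where "\<bar>x - y - L * of_int k\<bar> < 1"
proof -
  have "cls x \<in> S" "cls y \<in> S" using graph assms by (auto simp: simple_graph_def)
  then have "circle_dist L (cls x) (cls y) < 1" using gec assms by (auto simp: gec_def)
  then show thesis using that by (auto simp: circle_dist_less_iff[OF L0])
qed

text \<open>Extension is centred at a vertex, so density first supplies \<open>s\<close>. With
  \<open>B\<close> empty and the distance from \<open>s\<close> to the nearer end as tolerance, the
  vertex obtained lifts into the interval.\<close>

lemma common_neighbour_lift:
  assumes "u < v" "finite A" "A \<subseteq> S"
    and near: "\<And>t a. u < t \<Longrightarrow> t < v \<Longrightarrow> a \<in> A \<Longrightarrow> circle_dist L (cls t) a < 1"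
  obtains w where "u < w" "w < v" "cls w \<in> S" "\<And>a. a \<in> A \<Longrightarrow> (cls w, a) \<in> E"
proof -
  interpret Metric_space "carrier (circle L)" "circle_dist L" by (rule Metric_space_circle[OF L0])
  obtain s where s: "u < s" "s < v" "cls s \<in> S" using dense_lift[OF assms(1)] .
  have "A \<subseteq> mball (cls s) 1" using near s assms(3) S_carrier by (auto simp: in_mball)
  moreover have "0 < min (s - u) (v - s)" using s by simp
  ultimately have "\<exists>q \<in> S - (A \<union> {}). circle_dist L (cls s) q < min (s - u) (v - s) \<and>
      (\<forall>a\<in>A. (q, a) \<in> E) \<and> (\<forall>b\<in>{}. (q, b) \<notin> E)"
    using gec s(3) assms(2,3) unfolding gec_def by (metis Int_empty_right empty_subsetI finite.emptyI)
  then obtain q where q: "q \<in> S" "circle_dist L (cls s) q < min (s - u) (v - s)"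
    "\<forall>a\<in>A. (q, a) \<in> E" by blast
  obtain y where y: "q = cls y" using q S_cases by blast
  obtain k :: int where "\<bar>s - y - L * of_int k\<bar> < min (s - u) (v - s)"
    using q unfolding y circle_dist_less_iff[OF L0] by blast
  then show thesis using that[of "y + L * of_int k"] q
    by (auto simp: y circle_class_add_period)
qed

section \<open>Common neighbours and distance 2\<close>

definition near2 :: "real set \<Rightarrow> real set \<Rightarrow> bool" where
  "near2 a b \<longleftrightarrow> (\<exists>v\<in>S. (v, a) \<in> E \<and> (v, b) \<in> E)"

text \<open>One direction is the triangle inequality. For the other, the unit intervals around two
  close lifts overlap, and the overlap contains a vertex adjacent to both points.\<close>

lemma near2_iff:
  assumes "cls x \<in> S" "cls y \<in> S"
  shows "near2 (cls x) (cls y) \<longleftrightarrow> (\<exists>k::int. \<bar>x - y - L * of_int k\<bar> < 2)"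
proof
  assume "near2 (cls x) (cls y)"
  then obtain v where v: "v \<in> S" "(v, cls x) \<in> E" "(v, cls y) \<in> E" unfolding near2_def by blast
  obtain w where w: "v = cls w" using v S_cases by blast
  obtain i where i: "\<bar>w - x - L * of_int i\<bar> < 1" using v adj_lift unfolding w by metis
  obtain j where j: "\<bar>w - y - L * of_int j\<bar> < 1" using v adj_lift unfolding w by metis
  have "\<bar>x - y - L * of_int (j - i)\<bar> < 2" using i j by (simp add: algebra_simps abs_if split: if_splits)
  then show "\<exists>k::int. \<bar>x - y - L * of_int k\<bar> < 2" ..
next
  assume "\<exists>k::int. \<bar>x - y - L * of_int k\<bar> < 2"
  then obtain k :: int where k: "\<bar>x - y - L * of_int k\<bar> < 2" ..
  define y' where "y' = y + L * of_int k"
  have y': "cls y' = cls y" "\<bar>x - y'\<bar> < 2" using k by (simp_all add: y'_def circle_class_add_period)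
  have "circle_dist L (cls t) a < 1"
    if "max x y' - 1 < t" "t < min x y' + 1" "a \<in> {cls x, cls y'}" for t a
    using that by (auto simp: circle_dist_less_iff[OF L0] intro!: exI[of _ 0])
  moreover have "max x y' - 1 < min x y' + 1" using y' by (auto simp: max_def min_def)
  ultimately obtain w where "cls w \<in> S" "\<And>a. a \<in> {cls x, cls y'} \<Longrightarrow> (cls w, a) \<in> E"
    using common_neighbour_lift[of "max x y' - 1" "min x y' + 1" "{cls x, cls y'}"] assms y'
    by (metis empty_subsetI finite.emptyI finite.insertI insert_subset)
  then show "near2 (cls x) (cls y)" unfolding near2_def using y' by auto
qed

lemma near2_definable:
  assumes "finite V" "i \<in> V" "j \<in> V"
  shows "dfn V (\<lambda>e. near2 (e i) (e j))"
  unfolding near2_def by (intro definable_pred_intros) (use assms in auto)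

section \<open>Short arcs and their order\<close>

text \<open>The order of the half-open arc from \<open>s\<close> (excluded) to \<open>t\<close> (included);
  its reflexive instances say that a point lies on that arc.\<close>
definition arc_le :: "real \<Rightarrow> real \<Rightarrow> real set \<Rightarrow> real set \<Rightarrow> bool" where
  "arc_le s t a b \<longleftrightarrow> (\<exists>x y. s < x \<and> x \<le> y \<and> y \<le> t \<and> a = cls x \<and> b = cls y)"

lemma arc_le_self: "arc_le s t a a \<longleftrightarrow> (\<exists>x. s < x \<and> x \<le> t \<and> a = cls x)"
proof
  show "arc_le s t a a" if "\<exists>x. s < x \<and> x \<le> t \<and> a = cls x"
    using that unfolding arc_le_def by blast
  assume "arc_le s t a a"
  then obtain x y where "s < x" "x \<le> y" "y \<le> t" "a = cls x" unfolding arc_le_def by blast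
  then show "\<exists>x. s < x \<and> x \<le> t \<and> a = cls x" by (intro exI[of _ x]) auto
qed

text \<open>The balls of radius 2 around the two parameters lift to \<open>(s, s + 4)\<close> and
  \<open>(t, t + 4)\<close>. The bound 4 keeps \<open>(s, t]\<close> inside the first; the bound
  \<open>L - 4\<close> keeps the translate of the second by \<open>- L\<close> from reaching
  \<open>s\<close>.\<close>

lemma arc_mem_iff:
  assumes "cls (s + 2) \<in> S" "cls (t + 2) \<in> S" "s < t" "t - s < 4" "t - s < L - 4" "a \<in> S"
  shows "arc_le s t a a \<longleftrightarrow> near2 a (cls (s + 2)) \<and> \<not> near2 a (cls (t + 2))"
proof
  assume "arc_le s t a a"
  then obtain x where x: "s < x" "x \<le> t" "a = cls x" unfolding arc_le_self by blast
  have "\<bar>x - (s + 2) - L * of_int 0\<bar> < 2" using x assms(4) by simp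
  then have "near2 a (cls (s + 2))" using near2_iff assms x by blast
  moreover have "\<not> \<bar>x - (t + 2) - L * of_int k\<bar> < 2" for k :: int
    using int_multiple_cases[OF L0, of k] by cases (use x assms(3,4,5) in linarith)+
  ultimately show "near2 a (cls (s + 2)) \<and> \<not> near2 a (cls (t + 2))"
    using near2_iff assms x by blast
next
  assume *: "near2 a (cls (s + 2)) \<and> \<not> near2 a (cls (t + 2))"
  obtain x where x: "a = cls x" using assms S_cases by blast
  obtain k :: int where k: "\<bar>x - (s + 2) - L * of_int k\<bar> < 2" using * near2_iff assms x by blast
  moreover have "\<not> \<bar>x - (t + 2) - L * of_int k\<bar> < 2" using * near2_iff assms x by blast
  ultimately have "s < x - L * of_int k" "x - L * of_int k \<le> t" using assms(3) by linarith+
  moreover have "a = cls (x - L * of_int k)"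
    using circle_class_add_period[of L x "- k"] x by simp
  ultimately show "arc_le s t a a" unfolding arc_le_def by blast
qed

text \<open>The arc from \<open>s'\<close> to \<open>t'\<close> slightly enlarges
  \<open>(s - 2, t - 2]\<close>. A point \<open>w\<close> on it is within 2 of \<open>x\<close>
  exactly when \<open>w > x - 2\<close>: the bounds on \<eta> exclude the other end of the ball and
  its other translates. So the witness detects a gap between \<open>x - 2\<close> and
  \<open>y - 2\<close>.\<close>

lemma short_arc_less_iff:
  assumes "4 * \<eta> \<le> 4" "4 * \<eta> \<le> L - 4" "t - s < \<eta>"
    and "s' < s - 2" "t - 2 < t'" "s - 2 - s' < \<eta> / 2" "t' - (t - 2) < \<eta> / 2"
    and "s < x" "x \<le> t" "s < y" "y \<le> t" "cls x \<in> S" "cls y \<in> S"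
  shows "x < y \<longleftrightarrow> (\<exists>w\<in>S. arc_le s' t' w w \<and> near2 w (cls x) \<and> \<not> near2 w (cls y))"
proof
  assume "x < y"
  then obtain w where w: "x - 2 < w" "w < y - 2" "cls w \<in> S" using dense_lift[of "x - 2" "y - 2"] by auto
  have "arc_le s' t' (cls w) (cls w)"
    unfolding arc_le_def using w assms by (intro exI[of _ w]) auto
  moreover have "\<bar>w - x - L * of_int 0\<bar> < 2" using w assms by simp
  then have "near2 (cls w) (cls x)" using near2_iff assms w by blast
  moreover have "\<not> \<bar>w - y - L * of_int k\<bar> < 2" for k :: int
    using int_multiple_cases[OF L0, of k] by cases (use w assms(1-11) in linarith)+
  then have "\<not> near2 (cls w) (cls y)" using near2_iff assms w by blast
  ultimately show "\<exists>w\<in>S. arc_le s' t' w w \<and> near2 w (cls x) \<and> \<not> near2 w (cls y)" using w by blast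
next
  assume "\<exists>w\<in>S. arc_le s' t' w w \<and> near2 w (cls x) \<and> \<not> near2 w (cls y)"
  then obtain w where w: "cls w \<in> S" "s' < w" "w \<le> t'" "near2 (cls w) (cls x)" "\<not> near2 (cls w) (cls y)"
    unfolding arc_le_self by blast
  obtain k :: int where k: "\<bar>w - x - L * of_int k\<bar> < 2" using w near2_iff assms by blast
  have "k = 0" using int_multiple_cases[OF L0, of k] by cases (use k w(2,3) assms(1-11) in linarith)+
  \<comment> \<open>This means \<open>w \<le> y - 2\<close>, as \<open>w \<ge> y + 2\<close> is
    impossible on the arc; together with \<open>x - 2 < w\<close> it gives
    \<open>x < y\<close>.\<close>
  moreover have "\<not> \<bar>w - y - L * of_int 0\<bar> < 2" using w near2_iff assms by blast
  ultimately show "x < y" using k w assms by auto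
qed

lemma arc_mem_definable:
  assumes "cls (s + 2) \<in> S" "cls (t + 2) \<in> S" "s < t" "t - s < 4" "t - s < L - 4"
    and V: "finite V" "i \<in> V"
  shows "dfn V (\<lambda>e. arc_le s t (e i) (e i))"
proof -
  have p: "dfn V (\<lambda>e. near2 (e i) p)" if "p \<in> S" for p
    by (rule definable_pred_param[OF V(1) that]) (use V in \<open>auto intro!: near2_definable\<close>)
  have "dfn V (\<lambda>e. near2 (e i) (cls (s + 2)) \<and> \<not> near2 (e i) (cls (t + 2)))"
    by (intro definable_pred_intros p assms)
  then show ?thesis by (rule definable_pred_cong) (use arc_mem_iff assms in auto)
qed

lemma short_arc_le_definable:
  assumes \<eta>: "0 < \<eta>" "4 * \<eta> \<le> 4" "4 * \<eta> \<le> L - 4"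
    and st: "cls (s + 2) \<in> S" "cls (t + 2) \<in> S" "s < t" "t - s < \<eta>"
    and V: "finite V" "i \<in> V" "j \<in> V"
  shows "dfn V (\<lambda>e. arc_le s t (e i) (e j))"
proof -
  \<comment> \<open>Membership in the auxiliary arc is defined through \<open>s' + 2\<close> and
    \<open>t' + 2\<close>, so these are taken to be lifts of vertices just outside \<open>s\<close>
    and \<open>t\<close>.\<close>
  obtain x where x: "s - \<eta> / 2 < x" "x < s" "cls x \<in> S" using dense_lift[of "s - \<eta> / 2" s] \<eta> by auto
  obtain y where y: "t < y" "y < t + \<eta> / 2" "cls y \<in> S" using dense_lift[of t "t + \<eta> / 2"] \<eta> by auto
  define s' t' where "s' = x - 2" "t' = y - 2"
  have s't': "s' < s - 2" "t - 2 < t'" "s - 2 - s' < \<eta> / 2" "t' - (t - 2) < \<eta> / 2"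
    using x y by (auto simp: s'_t'_def)
  have "s' < t'" "t' - s' < 4" "t' - s' < L - 4" "t - s < 4" "t - s < L - 4"
    using s't' st \<eta> by linarith+
  moreover have "cls (s' + 2) \<in> S" "cls (t' + 2) \<in> S" using x y by (simp_all add: s'_t'_def)
  ultimately have mem: "dfn W (\<lambda>e. arc_le s' t' (e m) (e m))" "dfn W (\<lambda>e. arc_le s t (e m) (e m))"
    if "finite W" "m \<in> W" for W m
    using arc_mem_definable st that by simp_all
  have "dfn V (\<lambda>e. arc_le s t (e i) (e i) \<and> arc_le s t (e j) (e j) \<and>
      \<not> (\<exists>w\<in>S. arc_le s' t' w w \<and> near2 w (e j) \<and> \<not> near2 w (e i)))"
    by (intro definable_pred_intros mem near2_definable) (use V in auto)
  then show ?thesis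
  proof (rule definable_pred_cong)
    fix e :: "nat \<Rightarrow> real set"
    assume e: "\<And>i. i \<in> V \<Longrightarrow> e i \<in> S"
    note less = short_arc_less_iff[OF \<eta>(2,3) st(4) s't']
    show "arc_le s t (e i) (e i) \<and> arc_le s t (e j) (e j) \<and>
      \<not> (\<exists>w\<in>S. arc_le s' t' w w \<and> near2 w (e j) \<and> \<not> near2 w (e i)) \<longleftrightarrow> arc_le s t (e i) (e j)"
      (is "?l \<longleftrightarrow> ?r")
    proof
      assume l: ?l
      obtain x where x: "s < x" "x \<le> t" "e i = cls x" using l unfolding arc_le_self by blast
      obtain y where y: "s < y" "y \<le> t" "e j = cls y" using l unfolding arc_le_self by blast
      have "\<not> y < x" using l less[of y x] x y e[of i] e[of j] V by metis
      then show ?r unfolding arc_le_def using x y by (intro exI[of _ x] exI[of _ y]) simp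
    next
      assume ?r
      then obtain x y where xy: "s < x" "x \<le> y" "y \<le> t" "e i = cls x" "e j = cls y"
        unfolding arc_le_def by blast
      then have "arc_le s t (e i) (e i)" "arc_le s t (e j) (e j)"
        unfolding arc_le_self by (meson order.trans order.strict_trans2)+
      moreover have "\<not> (\<exists>w\<in>S. arc_le s' t' w w \<and> near2 w (e j) \<and> \<not> near2 w (e i))"
        using less[of y x] xy e[of i] e[of j] V by auto
      ultimately show ?l by blast
    qed
  qed
qed

section \<open>Concatenation of arcs\<close>

lemma arc_le_append:
  assumes "s < t" "t < u"
  shows "arc_le s u a b \<longleftrightarrow> arc_le s t a b \<or> arc_le t u a b \<or> (arc_le s t a a \<and> arc_le t u b b)"
    (is "?l \<longleftrightarrow> ?r")
proof
  assume ?l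
  then obtain x y where xy: "s < x" "x \<le> y" "y \<le> u" "a = cls x" "b = cls y"
    unfolding arc_le_def by blast
  consider "y \<le> t" | "t < x" | "x \<le> t" "t < y" by linarith
  then show ?r
  proof cases
    case 1 then show ?thesis unfolding arc_le_def using xy by blast
  next
    case 2 then show ?thesis unfolding arc_le_def using xy by blast
  next
    case 3
    then have "arc_le s t a a" "arc_le t u b b" unfolding arc_le_def using xy by blast+
    then show ?thesis by blast
  qed
next
  assume ?r
  then show ?l
  proof (elim disjE conjE)
    assume "arc_le s t a b" then show ?thesis unfolding arc_le_def using assms by fastforce
  next
    assume "arc_le t u a b" then show ?thesis
      unfolding arc_le_def using assms less_trans by blast
  next
    assume "arc_le s t a a" "arc_le t u b b"
    then obtain x y where "s < x" "x \<le> t" "a = cls x" "t < y" "y \<le> u" "b = cls y"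
      unfolding arc_le_self by blast
    then show ?thesis unfolding arc_le_def by (intro exI[of _ x] exI[of _ y]) simp
  qed
qed

lemma arc_le_definable:
  assumes \<eta>: "0 < \<eta>" "4 * \<eta> \<le> 4" "4 * \<eta> \<le> L - 4"
    and "cls (s + 2) \<in> S" "cls (t + 2) \<in> S" "s < t" "t - s < real n * \<eta>"
    and V: "finite V" "i \<in> V" "j \<in> V"
  shows "dfn V (\<lambda>e. arc_le s t (e i) (e j))"
  using assms(4-)
proof (induction n arbitrary: s i j)
  case 0
  then show ?case by simp
next
  case (Suc n)
  show ?case
  proof (cases "t - s < \<eta>")
    case True
    then show ?thesis using short_arc_le_definable[OF \<eta> Suc.prems(1-3) _ Suc.prems(5-7)] by simp
  next
    case False
    \<comment> \<open>The cut must come less than \<eta> after \<open>s\<close> and less than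
      \<open>real n * \<eta>\<close> before \<open>t\<close>; the bound on \<open>t - s\<close>
      leaves room. Density is applied after adding 2, since \<open>q + 2\<close> has to lift a
      vertex.\<close>
    have "max s (t - real n * \<eta>) + 2 < s + \<eta> + 2"
      using Suc.prems(4) \<eta>(1) by (auto simp: algebra_simps)
    then obtain m where m: "max s (t - real n * \<eta>) + 2 < m" "m < s + \<eta> + 2" "cls m \<in> S"
      using dense_lift by blast
    define q where "q = m - 2"
    have q: "s < q" "q < t" "q - s < \<eta>" "t - q < real n * \<eta>" "cls (q + 2) \<in> S"
      using m False by (auto simp: q_def)
    have "dfn V (\<lambda>e. arc_le s q (e k) (e l))" if "k \<in> V" "l \<in> V" for k l
      using short_arc_le_definable[OF \<eta> Suc.prems(1) q(5,1,3) V(1) that] .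
    moreover have "dfn V (\<lambda>e. arc_le q t (e k) (e l))" if "k \<in> V" "l \<in> V" for k l
      using Suc.IH[OF q(5) Suc.prems(2) q(2,4) V(1) that] .
    ultimately have "dfn V (\<lambda>e. arc_le s q (e i) (e j) \<or> arc_le q t (e i) (e j) \<or>
        (arc_le s q (e i) (e i) \<and> arc_le q t (e j) (e j)))"
      using Suc.prems(6,7) by (intro definable_pred_disj definable_pred_conj)
    then show ?thesis using arc_le_append[OF q(1,2)] by simp
  qed
qed

section \<open>The circular order from a full turn\<close>

lemma period_lift:
  obtains x' where "s < x'" "x' \<le> s + L" "cls x' = cls x"
proof -
  \<comment> \<open>The ceiling minus one, unlike the floor, gives a window open at \<open>s\<close>
    and closed at \<open>s + L\<close>, as in \<open>arc_le\<close>.\<close>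
  define k where "k = \<lceil>(x - s) / L\<rceil> - 1"
  have "of_int k < (x - s) / L" "(x - s) / L \<le> of_int k + 1" unfolding k_def by linarith+
  then have "L * of_int k < x - s" "x - s \<le> L * of_int k + L"
    using L0 by (simp_all add: field_simps)
  then show thesis using that[of "x - L * of_int k"] circle_class_add_period[of L x "- k"] by simp
qed

lemma period_lift_unique:
  assumes "s < x" "x \<le> s + L" "s < y" "y \<le> s + L" "cls x = cls y" shows "x = y"
proof -
  obtain k :: int where k: "x = y + L * of_int k" using assms circle_class_eq_iff by blast
  show ?thesis using int_multiple_cases[OF L0, of k] by cases (use k assms(1-4) in linarith)+
qed

lemma arc_le_period_iff:
  assumes "s < x" "x \<le> s + L" "s < y" "y \<le> s + L"
  shows "arc_le s (s + L) (cls x) (cls y) \<longleftrightarrow> x \<le> y"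
proof
  assume "arc_le s (s + L) (cls x) (cls y)"
  then obtain u v where "s < u" "u \<le> v" "v \<le> s + L" "cls x = cls u" "cls y = cls v"
    unfolding arc_le_def by blast
  then show "x \<le> y" using period_lift_unique[of s x u] period_lift_unique[of s y v] assms by auto
qed (use assms arc_le_def in blast)

text \<open>The window from \<open>s\<close> to \<open>s + L\<close> meets every class exactly once,
  so \<open>arc_le\<close> is a linear order there; the circular order does not depend on where the
  circle is cut.\<close>

lemma cyc_iff_arc_le:
  fixes s :: real
  defines "lt \<equiv> \<lambda>a b. arc_le s (s + L) a b \<and> a \<noteq> b"
  assumes "a \<in> carrier (circle L)" "b \<in> carrier (circle L)" "c \<in> carrier (circle L)"
  shows "cyc a b c \<longleftrightarrow> (lt a b \<and> lt b c) \<or> (lt b c \<and> lt c a) \<or> (lt c a \<and> lt a b)"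
proof -
  obtain x where x: "a = cls x" "s < x" "x \<le> s + L"
    using assms(2) period_lift unfolding carrier_circle by (metis imageE)
  obtain y where y: "b = cls y" "s < y" "y \<le> s + L"
    using assms(3) period_lift unfolding carrier_circle by (metis imageE)
  obtain z where z: "c = cls z" "s < z" "z \<le> s + L"
    using assms(4) period_lift unfolding carrier_circle by (metis imageE)
  have lt: "lt (cls u) (cls v) \<longleftrightarrow> u < v" if "s < u" "u \<le> s + L" "s < v" "v \<le> s + L" for u v
    using arc_le_period_iff[OF that] period_lift_unique[OF that] by (auto simp: lt_def)
  have "cyc (cls x) (cls y) (cls z) \<longleftrightarrow> (x < y \<and> y < z) \<or> (y < z \<and> z < x) \<or> (z < x \<and> x < y)"
  proof
    assume "cyc (cls x) (cls y) (cls z)"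
    then obtain y' z' where *: "cls y = cls y'" "cls z = cls z'" "x < y'" "y' < z'" "z' < x + L"
      using circ_orderE[OF L0] carrier_cls by metis
    obtain j :: int where j: "y' = y + L * of_int j" using * by (metis circle_class_eq_iff)
    obtain k :: int where k: "z' = z + L * of_int k" using * by (metis circle_class_eq_iff)
    \<comment> \<open>The lifts \<open>y'\<close> and \<open>z'\<close> lie within one period after
      \<open>x\<close>, so each is the point of the window or its next translate.
      \<open>j = 1\<close>, \<open>k = 0\<close> is contradictory; the other combinations are the
      three cyclic cases.\<close>
    have "j = 0 \<or> j = 1" "k = 0 \<or> k = 1"
      using * x y z j k by (intro int_multiple_0_1[OF L0]; linarith)+
    then show "(x < y \<and> y < z) \<or> (y < z \<and> z < x) \<or> (z < x \<and> x < y)"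
      using * x y z j k by auto
  next
    assume "(x < y \<and> y < z) \<or> (y < z \<and> z < x) \<or> (z < x \<and> x < y)"
    then show "cyc (cls x) (cls y) (cls z)"
      using circ_orderI[OF L0, of x y z] circ_orderI[OF L0, of y z x] circ_orderI[OF L0, of z x y] x y z
      by auto
  qed
  then show ?thesis using lt x y z by simp
qed

lemma cyc_definable:
  assumes V: "finite V" "i \<in> V" "j \<in> V" "k \<in> V"
  shows "dfn V (\<lambda>e. cyc (e i) (e j) (e k))"
proof -
  obtain x where x: "cls x \<in> S" using dense_lift[of 0 1] by auto
  \<comment> \<open>With this \<open>s\<close>, both ends of the full turn become lifts of the
    vertex \<open>cls x\<close> after adding 2.\<close>
  define s where "s = x - 2"
  \<comment> \<open>The largest \<eta> that meets both smallness conditions for short arcs.\<close>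
  define \<eta> where "\<eta> = min 4 (L - 4) / 4"
  have \<eta>: "0 < \<eta>" "4 * \<eta> \<le> 4" "4 * \<eta> \<le> L - 4" using L by (auto simp: \<eta>_def)
  obtain n where "L < real n * \<eta>" using \<eta>(1) reals_Archimedean3 by blast
  moreover have "cls (s + L + 2) \<in> S" "cls (s + 2) \<in> S"
    using x circle_class_add_period[of L x 1] by (simp_all add: s_def)
  ultimately have *: "dfn V (\<lambda>e. arc_le s (s + L) (e i) (e j))" if "i \<in> V" "j \<in> V" for i j
    using arc_le_definable[OF \<eta>, of s "s + L" n V i j] L0 V(1) that by simp
  let ?lt = "\<lambda>a b. arc_le s (s + L) a b \<and> a \<noteq> b"
  have "dfn V (\<lambda>e. (?lt (e i) (e j) \<and> ?lt (e j) (e k)) \<or> (?lt (e j) (e k) \<and> ?lt (e k) (e i)) \<or>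
      (?lt (e k) (e i) \<and> ?lt (e i) (e j)))"
    by (intro definable_pred_disj definable_pred_conj definable_pred_not definable_pred_eq * V)
  then show ?thesis
    by (rule definable_pred_cong) (intro cyc_iff_arc_le[symmetric] S_carrier, (use V in blast)+)
qed

section \<open>Adjacency to points outside \<open>S\<close>\<close>

text \<open>The open unit ball around \<open>p\<close> up to its boundary; unlike adjacency to \<open>p\<close>, this makes
  sense for points \<open>p\<close> outside \<open>S\<close>.\<close>
definition limit_adj :: "real set \<Rightarrow> real set \<Rightarrow> bool" where
  "limit_adj p x \<longleftrightarrow> (\<forall>w\<in>S. \<forall>y\<in>S. cyc w p y \<longrightarrow> (\<exists>v\<in>S. cyc w v y \<and> (v, x) \<in> E))"

text \<open>Every arc around \<open>p\<close> overlaps the unit interval around \<open>x\<close> in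
  an open interval, because \<open>p\<close> lies in both; a neighbour of \<open>cls x\<close> is
  found in the overlap.\<close>

lemma limit_adjI:
  assumes "\<bar>p - x\<bar> < 1" "cls x \<in> S"
  shows "limit_adj (cls p) (cls x)"
  unfolding limit_adj_def
proof (intro ballI impI)
  fix a b assume ab: "a \<in> S" "b \<in> S" "cyc a (cls p) b"
  then obtain y w where yw: "b = cls y" "a = cls w" "p < y" "y < w" "w < p + L"
    using circ_orderE[OF L0, of p b a] circ_order_rotate S_carrier by metis
  have "circle_dist L (cls t) (cls x) < 1" if "max (w - L) (x - 1) < t" "t < min y (x + 1)" for t
    unfolding circle_dist_less_iff[OF L0] using that by (intro exI[of _ 0]) auto
  moreover have "max (w - L) (x - 1) < min y (x + 1)" using yw assms by auto
  ultimately obtain v where v: "max (w - L) (x - 1) < v" "v < min y (x + 1)" "cls v \<in> S" "(cls v, cls x) \<in> E"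
    using common_neighbour_lift[of "max (w - L) (x - 1)" "min y (x + 1)" "{cls x}"] assms(2) by auto
  have "cyc (cls v) (cls y) (cls w)" using circ_orderI[OF L0, of v y w] v yw by auto
  then show "\<exists>v\<in>S. cyc a v b \<and> (v, cls x) \<in> E" using v yw circ_order_rotate by blast
qed

text \<open>If the lift of \<open>cls x\<close> nearest to \<open>p\<close> were farther than 1, a
  small enough arc around \<open>p\<close> would contain no neighbour of
  \<open>cls x\<close>.\<close>

lemma limit_adjD:
  assumes "limit_adj (cls p) (cls x)"
  obtains x' where "cls x' = cls x" "\<bar>p - x'\<bar> \<le> 1"
proof -
  obtain x' where x': "p - L / 2 < x'" "x' \<le> p - L / 2 + L" "cls x' = cls x"
    by (rule period_lift)
  have "\<bar>p - x'\<bar> \<le> 1"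
  proof (rule ccontr)
    \<comment> \<open>Points closer than this excess to \<open>p\<close> stay farther than 1 from
      \<open>x'\<close>; as \<epsilon> is at most \<open>L / 2 - 1\<close>, they also stay farther
      than 1 from its translates.\<close>
    define \<epsilon> where "\<epsilon> = \<bar>p - x'\<bar> - 1"
    assume "\<not> \<bar>p - x'\<bar> \<le> 1"
    then have \<epsilon>: "0 < \<epsilon>" "\<epsilon> \<le> L / 2 - 1" "\<bar>p - x'\<bar> = 1 + \<epsilon>" using x' by (auto simp: \<epsilon>_def abs_if)
    obtain w where w: "p - \<epsilon> < w" "w < p" "cls w \<in> S" using dense_lift[of "p - \<epsilon>" p] \<epsilon> by auto
    obtain y where y: "p < y" "y < p + \<epsilon>" "cls y \<in> S" using dense_lift[of p "p + \<epsilon>"] \<epsilon> by auto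
    have "cyc (cls w) (cls p) (cls y)" using circ_orderI[OF L0] w y \<epsilon> by simp
    then obtain q where q: "q \<in> S" "cyc (cls w) q (cls y)" "(q, cls x) \<in> E"
      using assms w y unfolding limit_adj_def by blast
    obtain v y' where v: "q = cls v" "cls y = cls y'" "w < v" "v < y'" "y' < w + L"
      using circ_orderE[OF L0 q(2)] S_carrier q(1) y(3) by metis
    have "y' = y" using period_lift_unique[of w y' y] v w y \<epsilon> by simp
    then have vy: "v < y" using v by simp
    obtain k where k: "\<bar>v - x' - L * of_int k\<bar> < 1"
      using q(3) adj_lift unfolding v x'(3)[symmetric] by metis
    have far: "\<bar>v - x'\<bar> > 1" using vy v(3) w(1) y(2) \<epsilon>(3) by linarith
    show False
      using int_multiple_cases[OF L0, of k] by cases (use far k x'(1,2) vy v(3) w(1) y(2) \<epsilon> in linarith)+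
  qed
  then show thesis using that x' by blast
qed

section \<open>Shifting by an integer\<close>

text \<open>\<open>limit_adj (cls p)\<close> holds inside the unit ball and fails outside its
  closure. Going from \<open>a\<close> to \<open>b\<close>, a vertex where it holds followed by one
  where it fails shows that \<open>p + 1\<close> is reached. Its unknown values on the boundary do
  no harm, as both witnesses lie strictly between \<open>a\<close> and \<open>b\<close>.\<close>

lemma shift_up_between_iff:
  assumes "a \<in> S" "b \<in> S"
  shows "cyc a (cls (p + 1)) b \<longleftrightarrow>
    (\<exists>u\<in>S. \<exists>v\<in>S. cyc a u b \<and> cyc u v b \<and> limit_adj (cls p) u \<and> \<not> limit_adj (cls p) v)"
proof
  assume "cyc a (cls (p + 1)) b"
  then obtain y x where yx: "b = cls y" "a = cls x" "p + 1 < y" "y < x" "x < p + 1 + L"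
    using circ_orderE[OF L0, of "p + 1" b a] circ_order_rotate S_carrier assms by metis
  obtain u where u: "max (x - L) p < u" "u < p + 1" "cls u \<in> S"
    using dense_lift[of "max (x - L) p" "p + 1"] yx by auto
  obtain v where v: "p + 1 < v" "v < min y (p + 2)" "cls v \<in> S"
    using dense_lift[of "p + 1" "min y (p + 2)"] yx by auto
  have "cyc a (cls u) b" using circ_orderI[OF L0, of u y x] u yx by auto
  moreover have "cyc (cls u) (cls v) b" using circ_orderI[OF L0, of u v y] u v yx by auto
  moreover have "limit_adj (cls p) (cls u)" using u by (intro limit_adjI) auto
  moreover have "\<not> limit_adj (cls p) (cls v)"
  proof
    assume "limit_adj (cls p) (cls v)"
    then obtain v' where v': "cls v' = cls v" "\<bar>p - v'\<bar> \<le> 1" by (rule limit_adjD)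
    have "v' = v"
      using v v'(2) L by (intro period_lift_unique[OF _ _ _ _ v'(1), of "p - 2"]) linarith+
    then show False using v v' by linarith
  qed
  ultimately show "\<exists>u\<in>S. \<exists>v\<in>S. cyc a u b \<and> cyc u v b \<and> limit_adj (cls p) u \<and> \<not> limit_adj (cls p) v"
    using u v by blast
next
  assume "\<exists>u\<in>S. \<exists>v\<in>S. cyc a u b \<and> cyc u v b \<and> limit_adj (cls p) u \<and> \<not> limit_adj (cls p) v"
  then obtain u v where uv: "u \<in> S" "v \<in> S" "cyc a u b" "cyc u v b" "limit_adj (cls p) u" "\<not> limit_adj (cls p) v"
    by blast
  obtain u0 where "u = cls u0" using uv S_cases by blast
  then obtain u' where u': "u = cls u'" "\<bar>p - u'\<bar> \<le> 1"
    using uv limit_adjD[of p u0] by metis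
  \<comment> \<open>Rotation to \<open>u\<close> lifts \<open>u\<close>, \<open>v\<close>,
    \<open>b\<close>, \<open>a\<close> in this order within one period.\<close>
  have "cyc u b a" using uv circ_order_rotate by blast
  then obtain v' b' a' where *: "v = cls v'" "b = cls b'" "a = cls a'" "u' < v'" "v' < b'" "b' < a'" "a' < u' + L"
    using circ_order_chainE[OF L0, of u' v b a] uv assms S_carrier unfolding u' by metis
  \<comment> \<open>Since \<open>v' > u' \<ge> p - 1\<close>, this means
    \<open>v' \<ge> p + 1\<close>.\<close>
  have "\<not> \<bar>p - v'\<bar> < 1" using limit_adjI[of p v'] uv * by blast
  then show "cyc a (cls (p + 1)) b"
    using circ_orderI(3)[OF L0, of "p + 1" b' a'] * u' by auto
qed

text \<open>Mirror image of the upward shift: the ball is entered at \<open>p - 1\<close>, so the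
  vertex where \<open>limit_adj (cls p)\<close> fails comes first.\<close>

lemma shift_down_between_iff:
  assumes "a \<in> S" "b \<in> S"
  shows "cyc a (cls (p - 1)) b \<longleftrightarrow>
    (\<exists>u\<in>S. \<exists>v\<in>S. cyc a u v \<and> cyc a v b \<and> \<not> limit_adj (cls p) u \<and> limit_adj (cls p) v)"
proof
  assume "cyc a (cls (p - 1)) b"
  then obtain y x where yx: "b = cls y" "a = cls x" "p - 1 < y" "y < x" "x < p - 1 + L"
    using circ_orderE[OF L0, of "p - 1" b a] circ_order_rotate S_carrier assms by metis
  obtain u where u: "max (x - L) (p - 2) < u" "u < p - 1" "cls u \<in> S"
    using dense_lift[of "max (x - L) (p - 2)" "p - 1"] yx by auto
  obtain v where v: "p - 1 < v" "v < min y p" "cls v \<in> S"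
    using dense_lift[of "p - 1" "min y p"] yx by auto
  have "cyc a (cls u) (cls v)" using circ_orderI[OF L0, of u v x] u v yx by auto
  moreover have "cyc a (cls v) b" using circ_orderI[OF L0, of v y x] u v yx by auto
  moreover have "limit_adj (cls p) (cls v)" using v by (intro limit_adjI) auto
  moreover have "\<not> limit_adj (cls p) (cls u)"
  proof
    assume "limit_adj (cls p) (cls u)"
    then obtain u' where u': "cls u' = cls u" "\<bar>p - u'\<bar> \<le> 1" by (rule limit_adjD)
    have "u' = u"
      using u u'(2) L by (intro period_lift_unique[OF _ _ _ _ u'(1), of "p - 2"]) linarith+
    then show False using u u' by linarith
  qed
  ultimately show "\<exists>u\<in>S. \<exists>v\<in>S. cyc a u v \<and> cyc a v b \<and> \<not> limit_adj (cls p) u \<and> limit_adj (cls p) v"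
    using u v by blast
next
  assume "\<exists>u\<in>S. \<exists>v\<in>S. cyc a u v \<and> cyc a v b \<and> \<not> limit_adj (cls p) u \<and> limit_adj (cls p) v"
  then obtain u v where uv: "u \<in> S" "v \<in> S" "cyc a u v" "cyc a v b" "\<not> limit_adj (cls p) u" "limit_adj (cls p) v"
    by blast
  obtain v0 where "v = cls v0" using uv S_cases by blast
  then obtain v' where v': "v = cls v'" "\<bar>p - v'\<bar> \<le> 1"
    using uv limit_adjD[of p v0] by metis
  have "cyc v b a" "cyc v a u" using uv circ_order_rotate by blast+
  then obtain b' a' u' where *: "b = cls b'" "a = cls a'" "u = cls u'" "v' < b'" "b' < a'" "a' < u'" "u' < v' + L"
    using circ_order_chainE[OF L0, of v' b a u] uv assms S_carrier unfolding v' by metis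
  \<comment> \<open>The lift of \<open>u\<close> just before \<open>v'\<close> is
    \<open>u' - L\<close>; being below \<open>p + 1\<close> and not within 1 of \<open>p\<close>, it
    is at most \<open>p - 1\<close>.\<close>
  have "cls (u' - L) = u" using circle_class_add_period[of L u' "-1"] * by simp
  then have "\<not> \<bar>p - (u' - L)\<bar> < 1" using limit_adjI[of p "u' - L"] uv by metis
  then show "cyc a (cls (p - 1)) b"
    using circ_orderI(3)[OF L0, of "p - 1" b' a'] * v' by auto
qed

text \<open>The point \<open>f (e i)\<close> may lie outside \<open>S\<close>, where no variable can
  denote it; \<open>limit_adj\<close> mentions it only as lying between two vertices, which is what
  \<open>between\<close> makes definable.\<close>

lemma limit_adj_definable:
  assumes between: "\<And>V i j k. finite V \<Longrightarrow> i \<in> V \<Longrightarrow> j \<in> V \<Longrightarrow> k \<in> V \<Longrightarrow> dfn V (\<lambda>e. cyc (e j) (f (e i)) (e k))"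
    and V: "finite V" "i \<in> V" "j \<in> V"
  shows "dfn V (\<lambda>e. limit_adj (f (e i)) (e j))"
  unfolding limit_adj_def
  by (intro definable_pred_intros between cyc_definable) (use V in auto)

lemma circle_shift_0: "a \<in> S \<Longrightarrow> circle_shift L a 0 = a"
  by (metis S_cases circle_shift_class add_0_right of_int_0)

lemma circle_shift_carrier: "a \<in> S \<Longrightarrow> circle_shift L a z \<in> carrier (circle L)"
  by (metis S_cases circle_shift_class carrier_cls)

text \<open>Induction from 0 in both directions: betweenness for \<open>z\<close> makes
  \<open>limit_adj\<close> around the shifted point definable, and its boundary gives betweenness
  for \<open>z + 1\<close> or \<open>z - 1\<close>. \<open>V\<close> and the indices stay arbitrary
  because quantifiers add fresh variables.\<close>

lemma between_shift_definable:
  assumes "finite V" "i \<in> V" "j \<in> V" "k \<in> V"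
  shows "dfn V (\<lambda>e. cyc (e j) (circle_shift L (e i) z) (e k))"
  using assms
proof (induction z arbitrary: V i j k rule: int_induct[of _ 0])
  case base
  show ?case
    by (rule definable_pred_cong[OF cyc_definable[OF base(1,3,2,4)]]) (use base circle_shift_0 in auto)
next
  case (step1 z)
  have "dfn V (\<lambda>e. \<exists>u\<in>S. \<exists>v\<in>S. cyc (e j) u (e k) \<and> cyc u v (e k) \<and>
      limit_adj (circle_shift L (e i) z) u \<and> \<not> limit_adj (circle_shift L (e i) z) v)"
    by (intro definable_pred_intros limit_adj_definable[where f = "\<lambda>a. circle_shift L a z"]
        cyc_definable step1.IH) (use step1.prems in auto)
  then show ?case
  proof (rule definable_pred_cong)
    fix e :: "nat \<Rightarrow> real set" assume e: "\<And>i. i \<in> V \<Longrightarrow> e i \<in> S"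
    then obtain x where "e i = cls x" using S_cases step1.prems by metis
    then show "(\<exists>u\<in>S. \<exists>v\<in>S. cyc (e j) u (e k) \<and> cyc u v (e k) \<and>
        limit_adj (circle_shift L (e i) z) u \<and> \<not> limit_adj (circle_shift L (e i) z) v) \<longleftrightarrow>
        cyc (e j) (circle_shift L (e i) (z + 1)) (e k)"
      using shift_up_between_iff[OF e e, OF step1.prems(3,4), of "x + of_int z"]
      by (simp add: circle_shift_class add.assoc)
  qed
next
  case (step2 z)
  have "dfn V (\<lambda>e. \<exists>u\<in>S. \<exists>v\<in>S. cyc (e j) u v \<and> cyc (e j) v (e k) \<and>
      \<not> limit_adj (circle_shift L (e i) z) u \<and> limit_adj (circle_shift L (e i) z) v)"
    by (intro definable_pred_intros limit_adj_definable[where f = "\<lambda>a. circle_shift L a z"]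
        cyc_definable step2.IH) (use step2.prems in auto)
  then show ?case
  proof (rule definable_pred_cong)
    fix e :: "nat \<Rightarrow> real set" assume e: "\<And>i. i \<in> V \<Longrightarrow> e i \<in> S"
    then obtain x where "e i = cls x" using S_cases step2.prems by metis
    then show "(\<exists>u\<in>S. \<exists>v\<in>S. cyc (e j) u v \<and> cyc (e j) v (e k) \<and>
        \<not> limit_adj (circle_shift L (e i) z) u \<and> limit_adj (circle_shift L (e i) z) v) \<longleftrightarrow>
        cyc (e j) (circle_shift L (e i) (z - 1)) (e k)"
      using shift_down_between_iff[OF e e, OF step2.prems(3,4), of "x + of_int z"]
      by (simp add: circle_shift_class add_diff_eq)
  qed
qed

section \<open>Definability of the relations and the shift functions\<close>

text \<open>All three points may lie outside \<open>S\<close>. Vertices chosen in the gaps between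
  them split the relation into conditions with at most one such point each, as
  \<open>between_shift_definable\<close> requires.\<close>

lemma cyc_iff_separated:
  assumes "a \<in> carrier (circle L)" "b \<in> carrier (circle L)" "c \<in> carrier (circle L)"
  shows "cyc a b c \<longleftrightarrow>
    (\<exists>x\<in>S. \<exists>y\<in>S. \<exists>z\<in>S. cyc x y z \<and> cyc x a y \<and> cyc y b z \<and> cyc z c x)"
proof
  assume "\<exists>x\<in>S. \<exists>y\<in>S. \<exists>z\<in>S. cyc x y z \<and> cyc x a y \<and> cyc y b z \<and> cyc z c x"
  then show "cyc a b c" unfolding circ_order_def Let_def by (smt (verit))
next
  assume abc: "cyc a b c"
  obtain a' where a': "a = cls a'" using assms by (auto simp: carrier_circle)
  obtain b' c' where *: "b = cls b'" "c = cls c'" "a' < b'" "b' < c'" "c' < a' + L"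
    using circ_orderE[OF L0, of a' b c] abc assms unfolding a' by metis
  obtain y where y: "a' < y" "y < b'" "cls y \<in> S" using dense_lift * by blast
  obtain z where z: "b' < z" "z < c'" "cls z \<in> S" using dense_lift * by blast
  obtain x where x: "c' < x" "x < a' + L" "cls x \<in> S" using dense_lift * by blast
  have "cyc (cls y) (cls z) (cls x)" "cyc a (cls y) (cls x)" "cyc (cls y) b (cls z)" "cyc (cls z) c (cls x)"
    using * x y z a' by (auto intro!: circ_orderI(1)[OF L0])
  then show "\<exists>x\<in>S. \<exists>y\<in>S. \<exists>z\<in>S. cyc x y z \<and> cyc x a y \<and> cyc y b z \<and> cyc z c x"
    using x y z circ_order_rotate by blast
qed

text \<open>If \<open>a\<close> and \<open>b\<close> differ, a vertex in each of the two gaps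
  between them gives an arc around \<open>a\<close> that omits \<open>b\<close>. This reduces an
  equation with a shifted point to betweenness.\<close>

lemma eq_iff_between:
  assumes "a \<in> carrier (circle L)" "b \<in> carrier (circle L)"
  shows "a = b \<longleftrightarrow> (\<forall>x\<in>S. \<forall>y\<in>S. cyc x a y \<longrightarrow> cyc x b y)"
proof
  assume R: "\<forall>x\<in>S. \<forall>y\<in>S. cyc x a y \<longrightarrow> cyc x b y"
  show "a = b"
  proof (rule ccontr)
    assume "a \<noteq> b"
    obtain a' where a': "a = cls a'" using assms by (auto simp: carrier_circle)
    obtain b' where b': "b = cls b'" "a' < b'" "b' \<le> a' + L"
      using assms(2) period_lift unfolding carrier_circle by (metis imageE)
    have "b' \<noteq> a' + L" using \<open>a \<noteq> b\<close> a' b' circle_class_add_period[of L a' 1] by auto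
    then have b'': "b' < a' + L" using b' by simp
    obtain y where y: "a' < y" "y < b'" "cls y \<in> S" using dense_lift b' by blast
    obtain x where x: "b' < x" "x < a' + L" "cls x \<in> S" using dense_lift b'' by blast
    have "cyc a (cls y) (cls x)" "cyc (cls y) b (cls x)"
      using x y a' b' by (auto intro!: circ_orderI(1)[OF L0])
    then have "cyc (cls x) b (cls y)" using R x y circ_order_rotate by blast
    with \<open>cyc (cls y) b (cls x)\<close> show False by (auto simp: circ_order_def Let_def)
  qed
qed simp

lemma circ_order_shift_definable:
  "definable_rel S E 3
     {[a, b, c] | a b c. a \<in> S \<and> b \<in> S \<and> c \<in> S \<and> circ_order_shift L z t k a b c}"
proof (rule definable_relI)
  let ?sh = "circle_shift L"
  have "dfn {..<3} (\<lambda>e. \<exists>x\<in>S. \<exists>y\<in>S. \<exists>w\<in>S. cyc x y w \<and> cyc x (?sh (e 0) z) y \<and>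
      cyc y (?sh (e 1) t) w \<and> cyc w (?sh (e 2) k) x)"
    by (intro definable_pred_intros cyc_definable between_shift_definable) auto
  then show "dfn {..<3} (\<lambda>e. circ_order_shift L z t k (e 0) (e 1) (e 2))"
  proof (rule definable_pred_cong)
    fix e :: "nat \<Rightarrow> real set" assume "\<And>i. i \<in> {..<3} \<Longrightarrow> e i \<in> S"
    then show "(\<exists>x\<in>S. \<exists>y\<in>S. \<exists>w\<in>S. cyc x y w \<and> cyc x (?sh (e 0) z) y \<and>
      cyc y (?sh (e 1) t) w \<and> cyc w (?sh (e 2) k) x) \<longleftrightarrow> circ_order_shift L z t k (e 0) (e 1) (e 2)"
      unfolding circ_order_shift_def
      by (intro cyc_iff_separated[symmetric] circle_shift_carrier) auto
  qed
next
  fix xs :: "real set list"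
  show "xs \<in> {[a, b, c] | a b c. a \<in> S \<and> b \<in> S \<and> c \<in> S \<and> circ_order_shift L z t k a b c} \<longleftrightarrow>
      length xs = 3 \<and> set xs \<subseteq> S \<and> circ_order_shift L z t k (xs ! 0) (xs ! 1) (xs ! 2)"
    by (auto simp: numeral_3_eq_3 numeral_2_eq_2 length_Suc_conv)
qed

text \<open>Equality of \<open>circle_shift L a z\<close> with a vertex already puts
  \<open>a\<close> in the domain of the partial function, so that equation describes its
  graph.\<close>

lemma shift_pfun_definable: "definable_pfun S E (shift_pfun L S z)"
  unfolding definable_pfun_def
proof (rule definable_relI)
  have "dfn {..<2} (\<lambda>e. \<forall>x\<in>S. \<forall>y\<in>S. cyc x (circle_shift L (e 0) z) y \<longrightarrow> cyc x (e 1) y)"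
    by (intro definable_pred_intros cyc_definable between_shift_definable) auto
  then show "dfn {..<2} (\<lambda>e. circle_shift L (e 0) z = e 1)"
  proof (rule definable_pred_cong)
    fix e :: "nat \<Rightarrow> real set" assume "\<And>i. i \<in> {..<2} \<Longrightarrow> e i \<in> S"
    then show "(\<forall>x\<in>S. \<forall>y\<in>S. cyc x (circle_shift L (e 0) z) y \<longrightarrow> cyc x (e 1) y) \<longleftrightarrow>
        circle_shift L (e 0) z = e 1"
      by (intro eq_iff_between[symmetric] circle_shift_carrier S_carrier) auto
  qed
next
  fix xs :: "real set list"
  show "xs \<in> {[a, b] | a b. shift_pfun L S z a = Some b} \<longleftrightarrow>
      length xs = 2 \<and> set xs \<subseteq> S \<and> circle_shift L (xs ! 0) z = xs ! 1"
    by (auto simp: numeral_2_eq_2 length_Suc_conv shift_pfun_def split: if_splits)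
qed

end

theorem corollary2p14:
  fixes L :: real and S :: "real set set" and E :: "real set rel"
  assumes "L > 4"
    and "dense_in (carrier (circle L)) (circle_dist L) S"
    and "simple_graph S E"
    and "gec (carrier (circle L)) (circle_dist L) S E"
  shows "(\<forall>z t k :: int. definable_rel S E 3
            {[a, b, c] | a b c. a \<in> S \<and> b \<in> S \<and> c \<in> S \<and> circ_order_shift L z t k a b c})
       \<and> (\<forall>z :: int. definable_pfun S E (shift_pfun L S z))"
proof -
  interpret gec_circle L S E using assms by unfold_locales
  show ?thesis using circ_order_shift_definable shift_pfun_definable by blast
qed

end
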